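(* Let $(X,d)$ be a metric space and let $n\ge 0$ be an integer. The microscopic Nagata-Assouad dimension of $(X,d)$ is at most $n$ if and only if the capacity dimension of $X$ is at most $n$.
   Context: A family of subsets of a metric space is $r$-disjoint if any two points lying in two different members of the family are at distance at least $r$. A metric space $Y$ satisfies $\dim_{NA}(Y)\le n$ (Nagata-Assouad dimension at most $n$) if there is $C>0$ such that for all $r>0$ there is a cover $\mathcal{U}=\bigcup_{i=1}^{n+1}\mathcal{U}_i$ of $Y$ such that each $\mathcal{U}_i$ is $r$-disjoint and every element of $\mathcal{U}$ has diameter at most $C r$. For $\epsilon>0$, $\min(d,\epsilon)$ denotes the metric $(x,y)\mapsto\min(d(x,y),\epsilon)$ on $X$. The microscopic Nagata-Assouad dimension of $(X,d)$ is $\dim_{NA}(X,\min(d,1))$. The capacity dimension (of Buyalo) of $(X,d)$ is at most $n$ if there is $C>0$ such that for all sufficiently small $r>0$ there is a cover $\mathcal{U}=\bigcup_{i=1}^{n+1}\mathcal{U}_i$ of $(X,d)$ such that each $\mathcal{U}_i$ is $r$-disjoint and every element of $\mathcal{U}$ has diameter at most $C r$. *)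

theory Defs
  imports "HOL-Analysis.Analysis"
begin

text \<open>A metric space is given by a carrier \<open>X\<close> and a distance function \<open>d\<close>, as in the locale
  \<^locale>\<open>Metric_space\<close>, since two metrics on the same set have to be compared.\<close>

definition r_disjoint :: "('a \<Rightarrow> 'a \<Rightarrow> real) \<Rightarrow> real \<Rightarrow> 'a set set \<Rightarrow> bool" where
  "r_disjoint d r \<U> \<longleftrightarrow>
     (\<forall>A\<in>\<U>. \<forall>B\<in>\<U>. A \<noteq> B \<longrightarrow> (\<forall>x\<in>A. \<forall>y\<in>B. d x y \<ge> r))"

text \<open>The diameter takes values in \<^typ>\<open>ennreal\<close>, so that an unbounded set has diameter
  \<open>\<infinity>\<close> (the library's \<^const>\<open>diameter\<close> is real-valued and unspecified on unbounded sets) and the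
  empty set has diameter \<open>0\<close>.\<close>

definition diam :: "('a \<Rightarrow> 'a \<Rightarrow> real) \<Rightarrow> 'a set \<Rightarrow> ennreal" where
  "diam d A = (SUP x\<in>A. SUP y\<in>A. ennreal (d x y))"

definition has_cover_at_scale ::
  "'a set \<Rightarrow> ('a \<Rightarrow> 'a \<Rightarrow> real) \<Rightarrow> nat \<Rightarrow> real \<Rightarrow> real \<Rightarrow> bool" where
  "has_cover_at_scale X d n C r \<longleftrightarrow>
     (\<exists>\<U> :: nat \<Rightarrow> 'a set set.
        (\<forall>i\<in>{1..n+1}. \<U> i \<subseteq> Pow X) \<and>
        \<Union>(\<Union>i\<in>{1..n+1}. \<U> i) = X \<and>
        (\<forall>i\<in>{1..n+1}. r_disjoint d r (\<U> i)) \<and>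
        (\<forall>A\<in>(\<Union>i\<in>{1..n+1}. \<U> i). diam d A \<le> ennreal (C * r)))"

definition NA_dim_le :: "'a set \<Rightarrow> ('a \<Rightarrow> 'a \<Rightarrow> real) \<Rightarrow> nat \<Rightarrow> bool" where
  "NA_dim_le X d n \<longleftrightarrow> (\<exists>C>0. \<forall>r>0. has_cover_at_scale X d n C r)"

text \<open>\<^term>\<open>Metric_space.capped_dist d 1\<close> is the metric \<open>min(d,1)\<close>.\<close>

definition microscopic_NA_dim_le :: "'a set \<Rightarrow> ('a \<Rightarrow> 'a \<Rightarrow> real) \<Rightarrow> nat \<Rightarrow> bool" where
  "microscopic_NA_dim_le X d n \<longleftrightarrow> NA_dim_le X (Metric_space.capped_dist d 1) n"

definition capacity_dim_le :: "'a set \<Rightarrow> ('a \<Rightarrow> 'a \<Rightarrow> real) \<Rightarrow> nat \<Rightarrow> bool" where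
  "capacity_dim_le X d n \<longleftrightarrow>
     (\<exists>C>0. \<forall>\<^sub>F r in at_right 0. has_cover_at_scale X d n C r)"

end

theory Submission imports Defs begin

text \<open>The metrics \<open>d\<close> and \<open>min(d,1)\<close> agree below distance \<open>1\<close>, so for small \<open>r\<close> a cover at scale
  \<open>r\<close> for one metric is a cover at scale \<open>r\<close> for the other. At any scale \<open>r \<ge> \<delta>\<close> the trivial cover
  \<open>{X}\<close> works for \<open>min(d,1)\<close>, since \<open>X\<close> then has diameter at most \<open>1 \<le> r / \<delta>\<close>.\<close>

text \<open>The sign condition matters because \<open>ennreal\<close> sends negative reals to
  0.\<close>

lemma diam_le_ennreal_iff:
  assumes "0 \<le> c"
  shows "diam d A \<le> ennreal c \<longleftrightarrow> (\<forall>x\<in>A. \<forall>y\<in>A. d x y \<le> c)"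
  using assms by (simp add: diam_def SUP_le_iff)

text \<open>The same family of sets serves for both metrics: separation survives if distances of at
  least \<open>r\<close> stay so, and the diameter bound survives if pairs within
  \<open>C * r\<close> end up within \<open>C' * r\<close>. Both directions of the theorem use this,
  with the roles of \<open>d\<close> and the capped metric exchanged.\<close>

lemma has_cover_at_scale_transfer:
  assumes cover: "has_cover_at_scale X d n C r"
    and nonneg: "0 \<le> C * r" "0 \<le> C' * r"
    and disj: "\<And>x y. \<lbrakk>x \<in> X; y \<in> X; r \<le> d x y\<rbrakk> \<Longrightarrow> r \<le> d' x y"
    and bound: "\<And>x y. \<lbrakk>x \<in> X; y \<in> X; d x y \<le> C * r\<rbrakk> \<Longrightarrow> d' x y \<le> C' * r"
  shows "has_cover_at_scale X d' n C' r"
proof -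
  obtain \<U> where sub: "\<forall>i\<in>{1..n+1}. \<U> i \<subseteq> Pow X"
    and cov: "\<Union>(\<Union>i\<in>{1..n+1}. \<U> i) = X"
    and sep: "\<forall>i\<in>{1..n+1}. r_disjoint d r (\<U> i)"
    and small: "\<forall>A\<in>(\<Union>i\<in>{1..n+1}. \<U> i). diam d A \<le> ennreal (C * r)"
    using cover unfolding has_cover_at_scale_def by (elim exE conjE)
  have "r_disjoint d' r (\<U> i)" if "i \<in> {1..n+1}" for i
    unfolding r_disjoint_def
  proof (intro ballI impI)
    fix A B x y assume AB: "A \<in> \<U> i" "B \<in> \<U> i" "A \<noteq> B" and xy: "x \<in> A" "y \<in> B"
    have "r_disjoint d r (\<U> i)"
      using sep that by simp
    then have "r \<le> d x y"
      using AB xy unfolding r_disjoint_def by simp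
    moreover have "\<U> i \<subseteq> Pow X"
      using sub that by simp
    then have "x \<in> X" "y \<in> X"
      using AB xy by auto
    ultimately show "r \<le> d' x y"
      by (simp add: disj)
  qed
  moreover have "diam d' A \<le> ennreal (C' * r)" if "A \<in> (\<Union>i\<in>{1..n+1}. \<U> i)" for A
  proof -
    have "A \<subseteq> X"
      using that cov by auto
    moreover have "diam d A \<le> ennreal (C * r)"
      using small that by (rule bspec)
    ultimately show ?thesis
      using nonneg bound by (simp add: diam_le_ennreal_iff subset_iff)
  qed
  ultimately show ?thesis
    unfolding has_cover_at_scale_def using sub cov
    by (intro exI[of _ \<U>] conjI ballI) simp_all
qed

lemma has_cover_at_scale_trivial:
  assumes "0 \<le> C * r" "\<And>x y. \<lbrakk>x \<in> X; y \<in> X\<rbrakk> \<Longrightarrow> d x y \<le> C * r"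
  shows "has_cover_at_scale X d n C r"
  unfolding has_cover_at_scale_def
  using assms by (intro exI[of _ "\<lambda>_. {X}"]) (auto simp: r_disjoint_def diam_le_ennreal_iff)

theorem corollary2p14:
  fixes X :: "'a set" and d :: "'a \<Rightarrow> 'a \<Rightarrow> real" and n :: nat
  assumes "Metric_space X d"
  shows "microscopic_NA_dim_le X d n \<longleftrightarrow> capacity_dim_le X d n"
proof -
  interpret Metric_space X d by fact
  show ?thesis
  proof
    assume "microscopic_NA_dim_le X d n"
    then obtain C where C: "C > 0" and cover: "\<And>r. r > 0 \<Longrightarrow> has_cover_at_scale X (capped_dist 1) n C r"
      unfolding microscopic_NA_dim_le_def NA_dim_le_def by blast
    \<comment> \<open>The threshold \<open>1 / C\<close> makes \<open>C * r < 1\<close>. A capped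
      distance of at most \<open>C * r\<close> is then below the cap, so it is the original
      distance.\<close>
    have "has_cover_at_scale X d n C r" if "0 < r" "r < 1 / C" for r
    proof (rule has_cover_at_scale_transfer[OF cover[OF \<open>0 < r\<close>]])
      have "C * r < 1"
        using that C by (simp add: field_simps)
      then show "d x y \<le> C * r" if "capped_dist 1 x y \<le> C * r" for x y
        using that by (simp add: capped_dist_def min_le_iff_disj)
    \<comment> \<open>Separation passes to \<open>d\<close> at every scale, as capping never
      increases a distance.\<close>
    qed (use C that in \<open>auto simp: capped_dist_def\<close>)
    then show "capacity_dim_le X d n"
      unfolding capacity_dim_le_def eventually_at_right_field
      using C by (intro exI[of _ C] conjI exI[of _ "1 / C"]) simp_all
  next
    assume "capacity_dim_le X d n"
    then obtain C b where C: "C > 0" and "b > 0"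
      and cover: "\<And>r. \<lbrakk>0 < r; r < b\<rbrakk> \<Longrightarrow> has_cover_at_scale X d n C r"
      unfolding capacity_dim_le_def eventually_at_right_field by blast
    \<comment> \<open>Below \<open>b\<close> covers for \<open>d\<close> are available; below 1
      capping preserves separation, since \<open>r \<le> d x y\<close> and \<open>r < 1\<close> give
      \<open>r \<le> min (d x y) 1\<close>.\<close>
    define \<delta> where "\<delta> = min b 1"
    \<comment> \<open>The term \<open>C\<close> serves the scales below \<open>\<delta>\<close>; the
      term \<open>1 / \<delta>\<close> ensures \<open>C' * r \<ge> 1\<close>, the largest possible
      capped distance, at all other scales.\<close>
    define C' where "C' = max C (1 / \<delta>)"
    have \<delta>: "0 < \<delta>" "\<delta> \<le> b" "\<delta> \<le> 1"
      using \<open>b > 0\<close> by (auto simp: \<delta>_def)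
    have C': "0 < C'" "C \<le> C'" "1 / \<delta> \<le> C'"
      using C by (auto simp: C'_def)
    have "has_cover_at_scale X (capped_dist 1) n C' r" if "0 < r" for r
    proof (cases "r < \<delta>")
      case True
      have "C * r \<le> C' * r"
        using C' that by (intro mult_right_mono) auto
      have "has_cover_at_scale X d n C r"
        using True \<delta> that by (intro cover) auto
      then show ?thesis
      proof (rule has_cover_at_scale_transfer)
        show "capped_dist 1 x y \<le> C' * r" if "d x y \<le> C * r" for x y
          using that \<open>C * r \<le> C' * r\<close> by (simp add: capped_dist_def min_le_iff_disj)
      qed (use True \<delta> C C' that in \<open>auto simp: capped_dist_def\<close>)
    next
      case False
      have "1 \<le> (1 / \<delta>) * r"
        using False \<delta> by (simp add: field_simps)
      also have "\<dots> \<le> C' * r"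
        using C' that by (intro mult_right_mono) auto
      finally have "1 \<le> C' * r" .
      then show ?thesis
        using C' that by (intro has_cover_at_scale_trivial) (simp_all add: capped_dist_def min_le_iff_disj)
    qed
    then show "microscopic_NA_dim_le X d n"
      unfolding microscopic_NA_dim_le_def NA_dim_le_def using C' by blast
  qed
qed

end
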